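(* Let $\mathcal{P}'\subseteq\mathcal{P}$ and $\mathcal{E}'\subseteq\mathcal{E}$ be arbitrary subsets, and for each integer $n\ge 0$ let $$\mathcal{A}(n)=\{(\lambda^{(1)},\lambda^{(2)},\lambda^{(3)}) : \lambda^{(1)},\lambda^{(2)}\in\mathcal{P}',\ \lambda^{(3)}\in\mathcal{E}',\ |\lambda^{(1)}|+|\lambda^{(2)}|+|\lambda^{(3)}|=n\}.$$ Then for all integers $n\ge 0$, $$\#\mathcal{A}(2n+1)\equiv 0 \pmod 2.$$
   Context: $\mathcal{P}$ is the set of all integer partitions (of all nonnegative integers, including the empty partition of $0$), and $\mathcal{E}$ is the set of all partitions all of whose parts are even (including the empty partition). $|\lambda|$ denotes the sum of the parts of $\lambda$. *)

theory Defs
  imports "HOL-Library.Multiset" "HOL-Number_Theory.Cong"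
begin

text \<open>
  An integer partition is the finite multiset of its parts, which are positive integers.
  The sum of the parts of \<open>p\<close> is \<open>\<Sum>\<^sub># p\<close>, and the empty partition of \<open>0\<close> is \<open>{#}\<close>.
\<close>

definition partitions :: "nat multiset set" where
  "partitions = {p. \<forall>k \<in># p. k > 0}"

definition even_partitions :: "nat multiset set" where
  "even_partitions = {p \<in> partitions. \<forall>k \<in># p. even k}"

definition partition_triples ::
  "nat multiset set \<Rightarrow> nat multiset set \<Rightarrow> nat \<Rightarrow> (nat multiset \<times> nat multiset \<times> nat multiset) set"
where
  "partition_triples P E n =
     {(p, q, r). p \<in> P \<and> q \<in> P \<and> r \<in> E \<and> \<Sum>\<^sub># p + \<Sum>\<^sub># q + \<Sum>\<^sub># r = n}"

text \<open>
  The set of triples is finite, so that its \<open>card\<close> is the true number of elements.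
\<close>

lemma size_le_sum_mset:
  assumes "p \<in> partitions"
  shows "size p \<le> \<Sum>\<^sub># p"
  using assms by (induction p) (auto simp: partitions_def)

lemma finite_partitions_le: "finite {p \<in> partitions. \<Sum>\<^sub># p \<le> n}"
proof (rule finite_subset)
  show "{p \<in> partitions. \<Sum>\<^sub># p \<le> n} \<subseteq> mset ` {xs. set xs \<subseteq> {..n} \<and> length xs \<le> n}"
  proof
    fix p assume p: "p \<in> {p \<in> partitions. \<Sum>\<^sub># p \<le> n}"
    obtain xs where xs: "mset xs = p"
      using ex_mset by blast
    have "k \<le> n" if "k \<in># p" for k
      using that p by (auto dest!: multi_member_split)
    moreover have "size p \<le> n"
      using size_le_sum_mset[of p] p by auto
    ultimately have "set xs \<subseteq> {..n} \<and> length xs \<le> n"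
      using xs by auto
    then show "p \<in> mset ` {xs. set xs \<subseteq> {..n} \<and> length xs \<le> n}"
      using xs by blast
  qed
qed (simp add: finite_lists_length_le)

lemma finite_partition_triples:
  assumes "P \<subseteq> partitions" "E \<subseteq> even_partitions"
  shows "finite (partition_triples P E n)"
proof (rule finite_subset)
  let ?B = "{p \<in> partitions. \<Sum>\<^sub># p \<le> n}"
  show "partition_triples P E n \<subseteq> ?B \<times> ?B \<times> ?B"
    using assms by (auto simp: partition_triples_def even_partitions_def)
qed (simp add: finite_partitions_le)

end

theory Submission
  imports Defs
begin

text \<open>
  Exchanging the first two components is an involution on the triples. It fixes exactly the
  triples \<open>(p, p, r)\<close>, and these have total weight \<open>2 * \<Sum>\<^sub># p + \<Sum>\<^sub># r\<close>, which is even since all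
  parts of \<open>r\<close> are. Hence for an odd weight the exchange has no fixed point, so it
  groups the triples into pairs.
\<close>

text \<open>
  The orbits \<open>{x, f x}\<close> partition \<open>A\<close>, and each has two elements.
\<close>

lemma even_card_if_fixpoint_free_involution:
  assumes "finite A"
    and closed: "\<And>x. x \<in> A \<Longrightarrow> f x \<in> A"
    and involution: "\<And>x. x \<in> A \<Longrightarrow> f (f x) = x"
    and fixpoint_free: "\<And>x. x \<in> A \<Longrightarrow> f x \<noteq> x"
  shows "even (card A)"
proof -
  let ?orbits = "(\<lambda>x. {x, f x}) ` A"
  have Union_orbits: "\<Union>?orbits = A"
    using closed by auto
  have "2 * card ?orbits = card (\<Union>?orbits)"
  proof (rule card_partition)
    show "finite ?orbits" "finite (\<Union>?orbits)"
      using \<open>finite A\<close> by (simp_all add: Union_orbits)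
    show "card c = 2" if "c \<in> ?orbits" for c
    proof -
      obtain x where "x \<in> A" "c = {x, f x}"
        using \<open>c \<in> ?orbits\<close> by blast
      then show ?thesis
        using fixpoint_free[of x] by auto
    qed
    show "c \<inter> d = {}" if "c \<in> ?orbits" "d \<in> ?orbits" "c \<noteq> d" for c d
    proof (rule ccontr)
      assume "c \<inter> d \<noteq> {}"
      obtain x y where xy: "x \<in> A" "c = {x, f x}" "y \<in> A" "d = {y, f y}"
        using \<open>c \<in> ?orbits\<close> \<open>d \<in> ?orbits\<close> by blast
      with \<open>c \<inter> d \<noteq> {}\<close> consider "x = y" | "x = f y" | "f x = y" | "f x = f y"
        by blast
      then have "c = d"
        using xy involution[of x] involution[of y] by cases (metis insert_commute)+
      with \<open>c \<noteq> d\<close> show False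
        by contradiction
    qed
  qed
  then show ?thesis
    unfolding Union_orbits by (rule dvdI[OF sym])
qed

lemma even_sum_mset_even_partition:
  assumes "r \<in> even_partitions"
  shows "even (\<Sum>\<^sub># r)"
proof -
  have "\<forall>k \<in># r. even k"
    using assms by (simp add: even_partitions_def)
  then show ?thesis
    by (induction r) auto
qed

theorem theorem7p1:
  fixes P E :: "nat multiset set" and n :: nat
  assumes "P \<subseteq> partitions"
    and "E \<subseteq> even_partitions"
  shows "[card (partition_triples P E (2 * n + 1)) = 0] (mod 2)"
proof -
  let ?T = "partition_triples P E (2 * n + 1)"
  have "even (card ?T)"
  proof (rule even_card_if_fixpoint_free_involution[where f = "\<lambda>(p, q, r). (q, p, r)"])
    show "finite ?T"
      using assms by (rule finite_partition_triples)
    fix t assume t: "t \<in> ?T"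
    obtain p q r where t_eq: "t = (p, q, r)"
      by (cases t)
    show "(case t of (p, q, r) \<Rightarrow> (q, p, r)) \<in> ?T"
      using t by (auto simp: partition_triples_def)
    show "(case (case t of (p, q, r) \<Rightarrow> (q, p, r)) of (p, q, r) \<Rightarrow> (q, p, r)) = t"
      by (simp add: t_eq)
    have "even (\<Sum>\<^sub># r)"
      using t assms(2) by (intro even_sum_mset_even_partition) (auto simp: t_eq partition_triples_def)
    moreover have "odd (\<Sum>\<^sub># p + \<Sum>\<^sub># q + \<Sum>\<^sub># r)"
      using t by (simp add: t_eq partition_triples_def)
    ultimately have "p \<noteq> q"
      by auto
    then show "(case t of (p, q, r) \<Rightarrow> (q, p, r)) \<noteq> t"
      by (simp add: t_eq)
  qed
  then show ?thesis
    by (simp add: cong_0_iff)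
qed

end
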